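(* Let data $(\hat U,\hat X,\hat W)$ be given and let $\gamma>0$. Suppose that there exist scalars $\lambda$ and $\beta$, and matrices $Q=Q^T>0$ and $L$, such that, with $C_L:=C_1Q+D_1L$ and $D:=[\hat X_+^T\ \ -\hat X_-^T\ \ -\hat U^T\ \ -\hat W^T\ \ 0\ \ 0\ \ 0]^T$ (block row sizes $p,p,q,l,p,l,q_1$), $$\begin{bmatrix}Q-\beta I&0&0&0&0&0&0\\ \ast&0&0&0&Q&0&0\\ \ast&\ast&0&0&L&0&0\\ \ast&\ast&\ast&0&0&I&0\\ \ast&\ast&\ast&\ast&Q&-C_L^TE_1&C_L^T\\ \ast&\ast&\ast&\ast&\ast&\gamma^2I-E_1^TE_1&0\\ \ast&\ast&\ast&\ast&\ast&\ast&I\end{bmatrix}+\lambda DD^T\ge0$$ and $$\begin{bmatrix}Q&-C_L^TE_1&C_L^T\\ \ast&\gamma^2I-E_1^TE_1&0\\ \ast&\ast&I\end{bmatrix}>0.$$ Then the data can be utilized for $H_\infty$ control with performance index $\gamma$; that is, with $K=LQ^{-1}$ and $u=Kx$, for every $(A,B,E)\in\Pi$ the closed-loop system is internally stable and has $H_\infty$ performance level $\gamma$ from $w$ to $y_1$.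
   Context: **System.** The true discrete-time linear time-invariant system is $$x(t+1)=A_\nu x(t)+B_\nu u(t)+E_\nu w(t),\quad y_1(t)=C_1x(t)+D_1u(t)+E_1w(t),$$ with $x\in\mathbb R^p$, $u\in\mathbb R^q$, $w\in\mathbb R^l$, $y_1\in\mathbb R^{q_1}$. The matrices $A_\nu,B_\nu,E_\nu$ are unknown; $C_1,D_1,E_1$ are known. Standing assumptions: $(A_\nu,B_\nu)$ is stabilizable and $(C_1,A_\nu)$ is observable. **Data.** $\hat X=[x(0)\ \cdots\ x(T)]$, $\hat U=[u(0)\ \cdots\ u(T-1)]$, $\hat W=[w(0)\ \cdots\ w(T-1)]$, $\hat X_-=[x(0)\ \cdots\ x(T-1)]$, $\hat X_+=[x(1)\ \cdots\ x(T)]$ are sampled from the true system, so $\hat X_+=A_\nu\hat X_-+B_\nu\hat U+E_\nu\hat W$. The disturbance samples satisfy $\sum_{t=0}^{T-1}\|w(t)\|^2\le\alpha$ for a given $\alpha\ge0$, with $\|w(t)\|^2\le\alpha_t$ for given $\alpha_t\ge 0$. **Compatible systems.** $\Pi=\{(A,B,E)\mid \hat X_+=A\hat X_-+B\hat U+E\hat W\}$. **Terminology.** For $(A,B,E)\in\Pi$ the closed loop is $x(t+1)=(A+BK)x(t)+Ew(t)$, $y_1(t)=(C_1+D_1K)x(t)+E_1w(t)$. It is internally stable if it is asymptotically stable for $w=0$. It has $H_\infty$ performance level $\gamma$ from $w$ to $y_1$ if, for zero initial condition, $\sum_{t=0}^\infty\|y_1(t)\|^2\le\gamma^2\sum_{t=0}^\infty\|w(t)\|^2$.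 The symbol $\ast$ denotes symmetric entries.
   Formalization: The scalar β is assumed to be nonnegative; for negative β the claim as stated is false (a scalar example with A=2, B=1, E=0, K=0, β=−12, λ=12 satisfies both inequalities but its closed loop is unstable). *)

theory Defs
  imports "HOL-Analysis.Analysis"
begin

definition hcat :: "real^'a^'m \<Rightarrow> real^'b^'m \<Rightarrow> real^('a + 'b)^'m" (infixr "|||" 54) where
  "A ||| B = (\<chi> i j. case j of Inl k \<Rightarrow> A $ i $ k | Inr k \<Rightarrow> B $ i $ k)"

definition vcat :: "real^'a^'m \<Rightarrow> real^'a^'n \<Rightarrow> real^'a^('m + 'n)" (infixr "'/'/'/" 52) where
  "A /// B = (\<chi> i j. case i of Inl k \<Rightarrow> A $ k $ j | Inr k \<Rightarrow> B $ k $ j)"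

definition positive_semidefinite :: "real^'n^'n \<Rightarrow> bool" where
  "positive_semidefinite M \<longleftrightarrow> transpose M = M \<and> (\<forall>z. 0 \<le> z \<bullet> (M *v z))"

definition positive_definite :: "real^'n^'n \<Rightarrow> bool" where
  "positive_definite M \<longleftrightarrow> transpose M = M \<and> (\<forall>z. z \<noteq> 0 \<longrightarrow> 0 < z \<bullet> (M *v z))"

definition autonomous_trajectory :: "real^'n^'n \<Rightarrow> (nat \<Rightarrow> real^'n) \<Rightarrow> bool" where
  "autonomous_trajectory A x \<longleftrightarrow> (\<forall>t. x (Suc t) = A *v x t)"

text \<open>Lyapunov stability of the origin together with convergence of every trajectory to it.\<close>

definition asymptotically_stable :: "real^'n^'n \<Rightarrow> bool" where
  "asymptotically_stable A \<longleftrightarrow>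
     (\<forall>\<epsilon>>0. \<exists>\<delta>>0. \<forall>x. autonomous_trajectory A x \<and> norm (x 0) < \<delta> \<longrightarrow> (\<forall>t. norm (x t) < \<epsilon>)) \<and>
     (\<forall>x. autonomous_trajectory A x \<longrightarrow> x \<longlonglongrightarrow> 0)"

definition stabilizable :: "real^'p^'p \<Rightarrow> real^'q^'p \<Rightarrow> bool" where
  "stabilizable A B \<longleftrightarrow> (\<exists>K :: real^'p^'q. asymptotically_stable (A + B ** K))"

definition observable :: "real^'p^'r \<Rightarrow> real^'p^'p \<Rightarrow> bool" where
  "observable C A \<longleftrightarrow>
     (\<forall>x x'. autonomous_trajectory A x \<and> autonomous_trajectory A x' \<and> (\<forall>t. C *v x t = C *v x' t)
        \<longrightarrow> x 0 = x' 0)"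

text \<open>
  The sums are taken in the extended nonnegative reals, so that no summability has to be assumed:
  the inequality includes that \<open>y\<close> is square summable whenever \<open>w\<close> is, and it holds trivially
  for \<open>\<gamma> > 0\<close> when \<open>w\<close> is not square summable.
\<close>

definition Hinf_performance ::
  "real^'p^'p \<Rightarrow> real^'l^'p \<Rightarrow> real^'p^'r \<Rightarrow> real^'l^'r \<Rightarrow> real \<Rightarrow> bool" where
  "Hinf_performance A E C F \<gamma> \<longleftrightarrow>
     (\<forall>x w y. x 0 = 0 \<and> (\<forall>t. x (Suc t) = A *v x t + E *v w t) \<and> (\<forall>t. y t = C *v x t + F *v w t)
        \<longrightarrow> (\<Sum>t. ennreal ((norm (y t))\<^sup>2)) \<le> ennreal (\<gamma>\<^sup>2) * (\<Sum>t. ennreal ((norm (w t))\<^sup>2)))"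

text \<open>
  The columns of a data matrix are indexed by a finite linearly ordered type with \<open>T\<close> elements,
  whose elements in increasing order stand for the sampling times \<open>0, \<dots>, T - 1\<close>.
\<close>

definition sample_time :: "'t::{finite,linorder} \<Rightarrow> nat" where
  "sample_time t = card {s. s < t}"

definition data_matrix :: "(nat \<Rightarrow> real^'n) \<Rightarrow> real^('t::{finite,linorder})^'n" where
  "data_matrix v = (\<chi> i t. v (sample_time t) $ i)"

definition shifted_data_matrix :: "(nat \<Rightarrow> real^'n) \<Rightarrow> real^('t::{finite,linorder})^'n" where
  "shifted_data_matrix v = (\<chi> i t. v (Suc (sample_time t)) $ i)"

definition compatible_systems ::
  "real^'t^'p \<Rightarrow> real^'t^'p \<Rightarrow> real^'t^'q \<Rightarrow> real^'t^'l
     \<Rightarrow> ((real^'p^'p) \<times> (real^'q^'p) \<times> (real^'l^'p)) set" where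
  "compatible_systems Xp Xm U W = {(A, B, E). Xp = A ** Xm + B ** U + E ** W}"

definition data_block ::
  "real^'t^'p \<Rightarrow> real^'t^'p \<Rightarrow> real^'t^'q \<Rightarrow> real^'t^'l
     \<Rightarrow> real^'t^('p + 'p + 'q + 'l + 'p + 'l + 'r::finite)" where
  "data_block Xp Xm U W = Xp /// - Xm /// - U /// - W /// 0 /// 0 /// 0"

definition performance_block ::
  "real^'p^'p \<Rightarrow> real^'p^'r \<Rightarrow> real^'l^'r \<Rightarrow> real \<Rightarrow> real^('p + 'l + 'r)^('p + 'l + 'r)" where
  "performance_block Q CL E1 \<gamma> =
     (Q                      ||| - (transpose CL ** E1)                        ||| transpose CL) ///
     (- (transpose E1 ** CL) ||| \<gamma>\<^sup>2 *\<^sub>R mat 1 - transpose E1 ** E1 ||| 0) ///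
     (CL                     ||| 0                                             ||| mat 1)"

definition design_block ::
  "real^'p^'p \<Rightarrow> real^'p^'q \<Rightarrow> real^'p^'r \<Rightarrow> real^'l^'r \<Rightarrow> real \<Rightarrow> real
     \<Rightarrow> real^('p + 'p + 'q + 'l + 'p + 'l + 'r)^('p + 'p + 'q + 'l + 'p + 'l + 'r)" where
  "design_block Q L CL E1 \<beta> \<gamma> =
     (Q - \<beta> *\<^sub>R mat 1 ||| 0 ||| 0 ||| 0 ||| 0 ||| 0 ||| 0) ///
     (0 ||| 0 ||| 0 ||| 0 ||| Q ||| 0 ||| 0) ///
     (0 ||| 0 ||| 0 ||| 0 ||| L ||| 0 ||| 0) ///
     (0 ||| 0 ||| 0 ||| 0 ||| 0 ||| mat 1 ||| 0) ///
     (0 ||| transpose Q ||| transpose L ||| 0 ||| Q ||| - (transpose CL ** E1) ||| transpose CL) ///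
     (0 ||| 0 ||| 0 ||| mat 1 ||| - (transpose E1 ** CL) ||| \<gamma>\<^sup>2 *\<^sub>R mat 1 - transpose E1 ** E1 ||| 0) ///
     (0 ||| 0 ||| 0 ||| 0 ||| CL ||| 0 ||| mat 1)"

end

theory Submission
  imports Defs
begin

text \<open>
  The proof reads the first matrix inequality along vectors that do not see the data. If
  \<open>(A, B, E)\<close> is compatible with the data, then \<open>D\<^sup>T \<zeta> = 0\<close> for every block vector
  \<open>\<zeta> = (z, A\<^sup>T z, B\<^sup>T z, E\<^sup>T z, \<xi>, \<omega>, \<eta>)\<close>, so the multiplier term \<open>\<lambda> D D\<^sup>T\<close> drops out and the design
  block itself is nonnegative at \<open>\<zeta>\<close> (\<open>data_block_system_test_vector\<close>). With \<open>\<eta> = - C\<^sub>L \<xi>\<close>, the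
  choice that makes the form least, this reads
  \[ z^T Q z - \beta |z|^2 + 2 z^T ((A Q + B L) \xi + E \omega) + \xi^T Q \xi
     + \gamma^2 |\omega|^2 - |C_L \xi + E_1 \omega|^2 \ge 0. \]
  Put \<open>V v = v\<^sup>T Q\<^sup>-\<^sup>1 v\<close> and \<open>K = L Q\<^sup>-\<^sup>1\<close>. For a state \<open>v\<close> and a disturbance \<open>\<omega>\<close>, take
  \<open>\<xi> = Q\<^sup>-\<^sup>1 v\<close>, let \<open>v'\<close> be the successor of \<open>v\<close> in the closed loop and \<open>y\<close> the output, and take
  \<open>z = - Q\<^sup>-\<^sup>1 v'\<close>. Since \<open>\<beta>\<close> is nonnegative, the inequality becomes the dissipation
  inequality \<open>V v' \<le> V v + \<gamma>\<^sup>2 |\<omega>|\<^sup>2 - |y|\<^sup>2\<close> (\<open>closed_loop_dissipation\<close>).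
  Summation over time gives the performance level (\<open>Hinf_performance_if_dissipative\<close>).

  Stability needs a strict decrease of \<open>V\<close> for \<open>\<omega> = 0\<close>, which for \<open>\<beta> = 0\<close> the inequality above
  does not show by itself. It follows from the full matrix inequality: a vector at which a
  positive semidefinite form vanishes lies in the kernel of its matrix
  (\<open>positive_semidefinite_null_vector\<close>), and the second block row of the design block maps \<open>\<zeta>\<close> to
  \<open>Q \<xi>\<close>. So the form is positive as soon as
  \<open>\<xi> \<noteq> 0\<close>, that is, as soon as the state is nonzero
  (\<open>design_inequality_on_compatible_systems\<close>).
\<close>

section \<open>Block vectors and quadratic forms\<close>

definition vjoin :: "real^'a \<Rightarrow> real^'b \<Rightarrow> real^('a + 'b)" where
  "vjoin a b = (\<chi> i. case i of Inl k \<Rightarrow> a $ k | Inr k \<Rightarrow> b $ k)"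

lemma sum_UNIV_Plus:
  fixes f :: "'a::finite + 'b::finite \<Rightarrow> 'c::comm_monoid_add"
  shows "sum f UNIV = (\<Sum>i\<in>UNIV. f (Inl i)) + (\<Sum>j\<in>UNIV. f (Inr j))"
  unfolding UNIV_Plus_UNIV[symmetric] by (subst sum.Plus) auto

lemma hcat_mult_vjoin: "(A ||| B) *v vjoin a b = A *v a + B *v b"
  by (simp add: vec_eq_iff hcat_def vjoin_def matrix_vector_mult_def sum_UNIV_Plus)

lemma vcat_mult: "(A /// B) *v v = vjoin (A *v v) (B *v v)"
  by (auto simp: vec_eq_iff vcat_def vjoin_def matrix_vector_mult_def split: sum.split)

lemma transpose_vcat: "transpose (A /// B) = transpose A ||| transpose B"
  by (auto simp: vec_eq_iff vcat_def hcat_def transpose_def split: sum.split)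

lemma inner_vjoin: "vjoin a b \<bullet> vjoin c d = a \<bullet> c + b \<bullet> d"
  by (simp add: inner_vec_def vjoin_def sum_UNIV_Plus)

lemma vjoin_eq_0_iff: "vjoin a b = 0 \<longleftrightarrow> a = 0 \<and> b = 0"
  by (auto simp: vec_eq_iff vjoin_def split_sum_all)

lemma transpose_matrix_mult_inner:
  fixes M :: "real^'n^'m"
  shows "(transpose M *v a) \<bullet> b = a \<bullet> (M *v b)"
  by (metis dot_lmul_matrix transpose_matrix_vector)

lemma inner_transpose_matrix_mult:
  fixes M :: "real^'n^'m"
  shows "b \<bullet> (transpose M *v a) = a \<bullet> (M *v b)"
  by (metis transpose_matrix_mult_inner inner_commute)

lemma matrix_vector_mult_minus_left: "(- M) *v v = - (M *v v)"
  for M :: "real^'n^'m"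
  by (simp add: vec_eq_iff matrix_vector_mult_def sum_negf)

lemma matrix_vector_mult_minus_right: "M *v (- v) = - (M *v v)"
  for M :: "real^'n^'m"
  by (simp add: vec_eq_iff matrix_vector_mult_def sum_negf)

lemma transpose_uminus: "transpose (- M) = - transpose M" for M :: "real^'n^'m"
  by (simp add: vec_eq_iff transpose_def)

lemma transpose_add: "transpose (M + N) = transpose M + transpose N" for M :: "real^'n^'m"
  by (simp add: vec_eq_iff transpose_def)

lemma transpose_zero: "transpose (0 :: real^'n^'m) = 0"
  by (simp add: vec_eq_iff transpose_def)

text \<open>A zero of a nonnegative quadratic form is a minimum, so the gradient vanishes there.\<close>

lemma positive_semidefinite_null_vector:
  assumes "positive_semidefinite M" and null: "v \<bullet> (M *v v) = 0"
  shows "M *v v = 0"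
proof (rule ccontr)
  let ?g = "M *v v"
  assume "?g \<noteq> 0"
  then have pos: "0 < ?g \<bullet> ?g" by simp
  have symmetric: "transpose M = M" and nonneg: "0 \<le> z \<bullet> (M *v z)" for z
    using assms(1) by (auto simp: positive_semidefinite_def)
  define c where "c = ?g \<bullet> (M *v ?g)"
  have c: "0 \<le> c" unfolding c_def by (rule nonneg)
  have cross: "v \<bullet> (M *v ?g) = ?g \<bullet> ?g"
    using transpose_matrix_mult_inner[of M v ?g] unfolding symmetric by (rule HOL.sym)
  have expand: "(v - s *\<^sub>R ?g) \<bullet> (M *v (v - s *\<^sub>R ?g)) = s\<^sup>2 * c - 2 * s * (?g \<bullet> ?g)" for s
    unfolding c_def
    by (simp add: matrix_vector_mult_diff_distrib matrix_vector_mult_scaleR inner_diff_left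
        inner_diff_right null cross power2_eq_square algebra_simps)
  \<comment> \<open>A descent step along the gradient; \<open>c + 1\<close> instead of \<open>c\<close> keeps the step size defined if \<open>c = 0\<close>.\<close>
  define s where "s = (?g \<bullet> ?g) / (c + 1)"
  have s: "0 < s" and sc: "s * (c + 1) = ?g \<bullet> ?g"
    using pos c by (auto simp: s_def)
  have "0 \<le> s * (s * c - 2 * (?g \<bullet> ?g))"
    using nonneg[of "v - s *\<^sub>R ?g"] unfolding expand by (simp add: power2_eq_square algebra_simps)
  then have "2 * (?g \<bullet> ?g) \<le> s * c" using s by (simp add: zero_le_mult_iff)
  then show False using sc s pos by (simp add: algebra_simps)
qed

text \<open>By homogeneity it suffices to bound the form on the unit sphere, which is compact.\<close>

lemma quadratic_form_coercive:
  fixes M :: "real^'n^'n"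
  assumes "\<And>v. v \<noteq> 0 \<Longrightarrow> 0 < v \<bullet> (M *v v)"
  obtains m where "0 < m" and "\<And>v. m * (norm v)\<^sup>2 \<le> v \<bullet> (M *v v)"
proof -
  let ?f = "\<lambda>v. v \<bullet> (M *v v)"
  have "continuous_on (sphere 0 1) ?f"
    by (intro continuous_on_inner continuous_on_id matrix_vector_mult_linear_continuous_on)
  moreover have "sphere (0 :: real^'n) 1 \<noteq> {}" by simp
  ultimately obtain a where a: "a \<in> sphere 0 1" and least: "\<And>v. v \<in> sphere 0 1 \<Longrightarrow> ?f a \<le> ?f v"
    using continuous_attains_inf[OF compact_sphere, of 0 1 ?f] by blast
  show thesis
  proof
    show "0 < ?f a" using a by (intro assms) auto
    fix v :: "real^'n"
    show "?f a * (norm v)\<^sup>2 \<le> ?f v"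
    proof (cases "v = 0")
      case False
      define e where "e = (1 / norm v) *\<^sub>R v"
      have e: "e \<in> sphere 0 1" and v: "norm v *\<^sub>R e = v" using False by (auto simp: e_def)
      have "?f a * (norm v)\<^sup>2 \<le> ?f e * (norm v)\<^sup>2" by (intro mult_right_mono least e) simp
      also have "\<dots> = ?f (norm v *\<^sub>R e)"
        by (simp add: matrix_vector_mult_scaleR power2_eq_square)
      finally show ?thesis unfolding v .
    qed simp
  qed
qed

lemma quadratic_form_bounded:
  fixes M :: "real^'n^'n"
  obtains b where "0 < b" and "\<And>v. v \<bullet> (M *v v) \<le> b * (norm v)\<^sup>2"
proof -
  obtain b where b: "0 < b" "\<And>v. norm (M *v v) \<le> norm v * b"
    using bounded_linear.pos_bounded[OF matrix_vector_mul_bounded_linear[of M]] by auto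
  have "v \<bullet> (M *v v) \<le> b * (norm v)\<^sup>2" for v
  proof -
    have "v \<bullet> (M *v v) \<le> norm v * norm (M *v v)" by (rule norm_cauchy_schwarz)
    also have "\<dots> \<le> norm v * (norm v * b)" by (intro mult_left_mono b) auto
    finally show ?thesis by (simp add: power2_eq_square mult.commute mult.left_commute)
  qed
  with b(1) show thesis by (rule that)
qed

lemma positive_definite_matrix_inv_right:
  assumes "positive_definite Q"
  shows "Q ** matrix_inv Q = mat 1"
proof -
  have "Q *v v = 0 \<Longrightarrow> v = 0" for v
    using assms by (force simp: positive_definite_def)
  then have "invertible Q"
    using invertible_left_inverse matrix_left_invertible_ker by blast
  then have "Q ** matrix_inv Q = mat 1 \<and> matrix_inv Q ** Q = mat 1"
    unfolding invertible_def matrix_inv_def by (rule someI_ex)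
  then show ?thesis ..
qed

section \<open>Lyapunov functions and dissipation\<close>

text \<open>
  Compactness turns the pointwise decrease of the Lyapunov function into a uniform
  contraction factor, and so the trajectories decay geometrically.
\<close>

lemma asymptotically_stable_if_strict_Lyapunov:
  fixes A S :: "real^'n^'n"
  assumes pos: "\<And>v. v \<noteq> 0 \<Longrightarrow> 0 < v \<bullet> (S *v v)"
    and decrease: "\<And>v. v \<noteq> 0 \<Longrightarrow> (A *v v) \<bullet> (S *v (A *v v)) < v \<bullet> (S *v v)"
  shows "asymptotically_stable A"
proof -
  define V where "V = (\<lambda>v. v \<bullet> (S *v v))"
  have diff_form: "v \<bullet> ((S - transpose A ** S ** A) *v v) = V v - V (A *v v)" for v
    by (simp add: V_def matrix_vector_mult_diff_rdistrib inner_diff_right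
        matrix_vector_mul_assoc[symmetric] inner_transpose_matrix_mult inner_commute
        del: transpose_matrix_vector)
  obtain m where m: "0 < m" "\<And>v. m * (norm v)\<^sup>2 \<le> V v"
    unfolding V_def using quadratic_form_coercive[OF pos] by blast
  obtain b where b: "0 < b" "\<And>v. V v \<le> b * (norm v)\<^sup>2"
    unfolding V_def using quadratic_form_bounded[of S] by blast
  obtain d where d: "0 < d" "\<And>v. d * (norm v)\<^sup>2 \<le> V v - V (A *v v)"
    using quadratic_form_coercive[of "S - transpose A ** S ** A"] decrease
    unfolding diff_form by (auto simp: V_def)
  define c where "c = max 0 (1 - d / b)"
  have c: "0 \<le> c" "c < 1" using b(1) d(1) by (auto simp: c_def)
  have V_nonneg: "0 \<le> V v" for v using m(1) m(2)[of v] by (smt (verit) zero_le_mult_iff zero_le_power2)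
  have contract: "V (A *v v) \<le> c * V v" for v
  proof -
    have "V (A *v v) \<le> V v - d * (norm v)\<^sup>2" using d(2)[of v] by simp
    also have "d / b * V v \<le> d / b * (b * (norm v)\<^sup>2)"
      using b d(1) by (intro mult_left_mono) auto
    then have "V v - d * (norm v)\<^sup>2 \<le> (1 - d / b) * V v"
      using b(1) by (simp add: algebra_simps)
    also have "\<dots> \<le> c * V v" unfolding c_def by (intro mult_right_mono V_nonneg) auto
    finally show ?thesis .
  qed
  have decay: "(norm (x t))\<^sup>2 \<le> b / m * (norm (x 0))\<^sup>2 * c ^ t" if "autonomous_trajectory A x" for x t
  proof -
    have "V (x t) \<le> c ^ t * V (x 0)"
    proof (induction t)
      case (Suc t)
      have "V (x (Suc t)) \<le> c * V (x t)"
        using contract that by (simp add: autonomous_trajectory_def)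
      also have "\<dots> \<le> c * (c ^ t * V (x 0))" using Suc c(1) by (rule mult_left_mono)
      finally show ?case by simp
    qed simp
    also have "\<dots> \<le> c ^ t * (b * (norm (x 0))\<^sup>2)" using c(1) b(2) by (intro mult_left_mono) auto
    finally have "m * (norm (x t))\<^sup>2 \<le> c ^ t * (b * (norm (x 0))\<^sup>2)" using m(2)[of "x t"] by linarith
    then show ?thesis using m(1) by (simp add: field_simps)
  qed
  show ?thesis unfolding asymptotically_stable_def
  proof (intro conjI allI impI)
    fix \<epsilon> :: real assume \<epsilon>: "0 < \<epsilon>"
    \<comment> \<open>The factor by which the norm can grow along a trajectory is at most \<open>sqrt (b / m)\<close>.\<close>
    define \<delta> where "\<delta> = \<epsilon> / sqrt (b / m)"
    have "norm (x t) < \<epsilon>" if x: "autonomous_trajectory A x" "norm (x 0) < \<delta>" for x t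
    proof -
      have "(norm (x t))\<^sup>2 \<le> b / m * (norm (x 0))\<^sup>2 * c ^ t" by (rule decay[OF x(1)])
      also have "\<dots> \<le> b / m * (norm (x 0))\<^sup>2"
        using c m(1) b(1) by (intro mult_left_le power_le_one) auto
      also have "\<dots> < b / m * \<delta>\<^sup>2"
        using x(2) m(1) b(1) by (intro mult_strict_left_mono power_strict_mono) auto
      also have "\<dots> = \<epsilon>\<^sup>2" using m(1) b(1) by (simp add: \<delta>_def power_divide)
      finally show ?thesis using \<epsilon> by (simp add: power_less_imp_less_base)
    qed
    moreover have "0 < \<delta>" using \<epsilon> m(1) b(1) by (simp add: \<delta>_def)
    ultimately show "\<exists>\<delta>>0. \<forall>x. autonomous_trajectory A x \<and> norm (x 0) < \<delta> \<longrightarrow> (\<forall>t. norm (x t) < \<epsilon>)"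
      by blast
  next
    fix x assume x: "autonomous_trajectory A x"
    have "(\<lambda>t. b / m * (norm (x 0))\<^sup>2 * c ^ t) \<longlonglongrightarrow> 0"
      using c by (intro tendsto_mult_right_zero LIMSEQ_power_zero) auto
    then have "(\<lambda>t. (norm (x t))\<^sup>2) \<longlonglongrightarrow> 0"
      by (rule tendsto_sandwich[OF always_eventually always_eventually tendsto_const, rotated 2])
        (use decay[OF x] in simp_all)
    then show "x \<longlonglongrightarrow> 0"
      by (simp add: power_tendsto_0_iff tendsto_norm_zero_iff)
  qed
qed

text \<open>
  The storage function is zero at the start and nonnegative at the end, so the supplied energy
  bounds the output energy over every finite horizon.
\<close>

lemma Hinf_performance_if_dissipative:
  fixes V :: "real^'p \<Rightarrow> real"
  assumes "V 0 = 0" and nonneg: "\<And>v. 0 \<le> V v"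
    and dissip: "\<And>v \<omega>. V (A *v v + E *v \<omega>) \<le> V v + \<gamma>\<^sup>2 * (norm \<omega>)\<^sup>2 - (norm (C *v v + F *v \<omega>))\<^sup>2"
  shows "Hinf_performance A E C F \<gamma>"
  unfolding Hinf_performance_def
proof (intro allI impI)
  fix x w y
  assume *: "x 0 = 0 \<and> (\<forall>t. x (Suc t) = A *v x t + E *v w t) \<and> (\<forall>t. y t = C *v x t + F *v w t)"
  have bal: "V (x n) + (\<Sum>t<n. (norm (y t))\<^sup>2) \<le> \<gamma>\<^sup>2 * (\<Sum>t<n. (norm (w t))\<^sup>2)" for n
  proof (induction n)
    case (Suc n)
    have "V (x (Suc n)) \<le> V (x n) + \<gamma>\<^sup>2 * (norm (w n))\<^sup>2 - (norm (y n))\<^sup>2"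
      using dissip * by simp
    with Suc show ?case by (simp add: algebra_simps)
  qed (use * assms(1) in simp)
  show "(\<Sum>t. ennreal ((norm (y t))\<^sup>2)) \<le> ennreal (\<gamma>\<^sup>2) * (\<Sum>t. ennreal ((norm (w t))\<^sup>2))"
  proof (rule suminf_le_const[OF summableI])
    fix n
    have "(\<Sum>t<n. ennreal ((norm (y t))\<^sup>2)) = ennreal (\<Sum>t<n. (norm (y t))\<^sup>2)"
      by (simp add: sum_ennreal)
    also have "\<dots> \<le> ennreal (\<gamma>\<^sup>2 * (\<Sum>t<n. (norm (w t))\<^sup>2))"
      using bal[of n] nonneg[of "x n"] by (intro ennreal_leI) linarith
    also have "\<dots> = ennreal (\<gamma>\<^sup>2) * (\<Sum>t<n. ennreal ((norm (w t))\<^sup>2))"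
      by (simp add: ennreal_mult sum_nonneg sum_ennreal)
    also have "\<dots> \<le> ennreal (\<gamma>\<^sup>2) * (\<Sum>t. ennreal ((norm (w t))\<^sup>2))"
      by (intro mult_left_mono sum_le_suminf summableI) auto
    finally show "(\<Sum>t<n. ennreal ((norm (y t))\<^sup>2)) \<le> \<dots>" .
  qed
qed

section \<open>The design inequality on the compatible systems\<close>

text \<open>
  The first four blocks are the image of \<open>z\<close> under the transpose of \<open>[I A B E]\<close>, which annihilates
  the data blocks exactly when \<open>(A, B, E)\<close> fits the data; the last three meet zero blocks of \<open>D\<close>
  and stay free.
\<close>

definition system_test_vector ::
  "real^'p^'p \<Rightarrow> real^'q^'p \<Rightarrow> real^'l^'p \<Rightarrow> real^'p \<Rightarrow> real^'p \<Rightarrow> real^'l \<Rightarrow> real^'r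
     \<Rightarrow> real^('p + 'p + 'q + 'l + 'p + 'l + 'r)" where
  "system_test_vector A B E z \<xi> \<omega> \<eta> =
     vjoin z (vjoin (transpose A *v z) (vjoin (transpose B *v z) (vjoin (transpose E *v z)
       (vjoin \<xi> (vjoin \<omega> \<eta>)))))"

lemma data_block_system_test_vector:
  assumes "(A, B, E) \<in> compatible_systems Xp Xm U W"
  shows "transpose (data_block Xp Xm U W) *v system_test_vector A B E z \<xi> \<omega> \<eta> = 0"
proof -
  have "Xp = A ** Xm + B ** U + E ** W" using assms by (simp add: compatible_systems_def)
  then have "transpose Xp *v z =
      transpose Xm *v (transpose A *v z) + transpose U *v (transpose B *v z)
      + transpose W *v (transpose E *v z)"
    by (simp add: transpose_add matrix_transpose_mul matrix_vector_mult_add_rdistrib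
        matrix_vector_mul_assoc[symmetric] del: transpose_matrix_vector)
  then show ?thesis
    by (simp add: data_block_def system_test_vector_def transpose_vcat hcat_mult_vjoin
        transpose_uminus transpose_zero matrix_vector_mult_minus_left
        del: transpose_matrix_vector)
qed

text \<open>
  The last component \<open>- C\<^sub>L \<xi>\<close> minimizes the form, a Schur complement with respect to the last
  block. It supplies the \<open>- |C\<^sub>L \<xi>|\<^sup>2\<close> that completes the square \<open>|C\<^sub>L \<xi> + E\<^sub>1 \<omega>|\<^sup>2\<close>, whose other
  terms are already in the block.
\<close>

lemma design_block_system_test_vector:
  fixes A Q :: "real^'p^'p" and B :: "real^'q^'p" and E :: "real^'l^'p"
    and CL :: "real^'p^'r" and z \<xi> :: "real^'p" and \<omega> :: "real^'l"
  defines "v \<equiv> system_test_vector A B E z \<xi> \<omega> (- (CL *v \<xi>))"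
  shows "v \<bullet> (design_block Q L CL E1 \<beta> \<gamma> *v v) =
    z \<bullet> (Q *v z) - \<beta> * (norm z)\<^sup>2 + 2 * (z \<bullet> ((A ** Q + B ** L) *v \<xi> + E *v \<omega>))
    + \<xi> \<bullet> (Q *v \<xi>) + \<gamma>\<^sup>2 * (norm \<omega>)\<^sup>2 - (norm (CL *v \<xi> + E1 *v \<omega>))\<^sup>2"
  unfolding v_def system_test_vector_def design_block_def power2_norm_eq_inner
  by (simp add: vcat_mult hcat_mult_vjoin inner_vjoin
      matrix_vector_mult_minus_left matrix_vector_mult_minus_right
      matrix_vector_mult_add_rdistrib matrix_vector_mult_diff_rdistrib
      matrix_vector_right_distrib scaleR_matrix_vector_assoc[symmetric]
      inner_add_left inner_add_right inner_diff_right matrix_vector_mul_assoc[symmetric]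
      transpose_matrix_mult_inner inner_transpose_matrix_mult
      inner_commute[of "E1 *v \<omega>" "CL *v \<xi>"] algebra_simps
      del: transpose_matrix_vector)

text \<open>
  On test vectors the two matrices of the design inequality act like the design block alone, whose
  second block row yields \<open>Q \<xi>\<close>. If the form vanishes at such a vector, so does the image of the
  vector, and with it \<open>Q \<xi>\<close>: this is where strictness comes from, even for \<open>\<beta> = 0\<close>.
\<close>

lemma design_inequality_on_compatible_systems:
  fixes A Q :: "real^'p^'p" and B :: "real^'q^'p" and E :: "real^'l^'p"
    and CL :: "real^'p^'r" and z \<xi> :: "real^'p" and \<omega> :: "real^'l"
  assumes compat: "(A, B, E) \<in> compatible_systems Xp Xm U W"
    and psd: "positive_semidefinite (design_block Q L CL E1 \<beta> \<gamma>
           + lam *\<^sub>R (data_block Xp Xm U W ** transpose (data_block Xp Xm U W)))"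
    and \<beta>: "0 \<le> \<beta>"
  defines "q \<equiv> z \<bullet> (Q *v z) + 2 * (z \<bullet> ((A ** Q + B ** L) *v \<xi> + E *v \<omega>))
    + \<xi> \<bullet> (Q *v \<xi>) + \<gamma>\<^sup>2 * (norm \<omega>)\<^sup>2 - (norm (CL *v \<xi> + E1 *v \<omega>))\<^sup>2"
  shows "0 \<le> q" and "Q *v \<xi> \<noteq> 0 \<Longrightarrow> 0 < q"
proof -
  define v where "v = system_test_vector A B E z \<xi> \<omega> (- (CL *v \<xi>))"
  let ?M = "design_block Q L CL E1 \<beta> \<gamma>"
  let ?N = "?M + lam *\<^sub>R (data_block Xp Xm U W ** transpose (data_block Xp Xm U W))"
  have Nv: "?N *v v = ?M *v v"
    by (simp add: v_def data_block_system_test_vector[OF compat]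
        matrix_vector_mult_add_rdistrib scaleR_matrix_vector_assoc[symmetric]
        matrix_vector_mul_assoc[symmetric] del: transpose_matrix_vector)
  have q: "v \<bullet> (?M *v v) = q - \<beta> * (norm z)\<^sup>2"
    unfolding v_def q_def design_block_system_test_vector by simp
  have form_nonneg: "0 \<le> v \<bullet> (?M *v v)"
    using psd Nv by (metis positive_semidefinite_def)
  have \<beta>z: "0 \<le> \<beta> * (norm z)\<^sup>2" using \<beta> by simp
  show "0 \<le> q" using form_nonneg \<beta>z q by linarith
  assume "Q *v \<xi> \<noteq> 0"
  then have "?M *v v \<noteq> 0"
    by (simp add: v_def design_block_def system_test_vector_def vcat_mult hcat_mult_vjoin
        vjoin_eq_0_iff)
  then have "v \<bullet> (?M *v v) \<noteq> 0"
    using positive_semidefinite_null_vector[OF psd, of v] Nv by auto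
  then show "0 < q" using form_nonneg \<beta>z q by linarith
qed

text \<open>
  Here the state is \<open>v = Q \<xi>\<close>, and \<open>z\<close> is the minimizer of the form: completing the square turns
  \<open>z\<^sup>T Q z + 2 z\<^sup>T v\<^sub>+\<close> into \<open>- V v\<^sub>+\<close>, where \<open>v\<^sub>+\<close> is the successor state.
\<close>

lemma closed_loop_dissipation:
  fixes A Q :: "real^'p^'p" and B :: "real^'q^'p" and E :: "real^'l^'p"
    and C1 :: "real^'p^'r" and v :: "real^'p" and \<omega> :: "real^'l"
  assumes compat: "(A, B, E) \<in> compatible_systems Xp Xm U W"
    and psd: "positive_semidefinite (design_block Q L (C1 ** Q + D1 ** L) E1 \<beta> \<gamma>
           + lam *\<^sub>R (data_block Xp Xm U W ** transpose (data_block Xp Xm U W)))"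
    and \<beta>: "0 \<le> \<beta>" and Q: "positive_definite Q"
  defines "K \<equiv> L ** matrix_inv Q" and "V \<equiv> \<lambda>v. v \<bullet> (matrix_inv Q *v v)"
  defines "bound \<equiv> V v + \<gamma>\<^sup>2 * (norm \<omega>)\<^sup>2 - (norm ((C1 + D1 ** K) *v v + E1 *v \<omega>))\<^sup>2"
  shows "V ((A + B ** K) *v v + E *v \<omega>) \<le> bound"
    and "v \<noteq> 0 \<Longrightarrow> V ((A + B ** K) *v v + E *v \<omega>) < bound"
proof -
  define \<xi> where "\<xi> = matrix_inv Q *v v"
  define v' where "v' = (A + B ** K) *v v + E *v \<omega>"
  define z where "z = - (matrix_inv Q *v v')"
  have Q_inv: "Q *v (matrix_inv Q *v a) = a" for a
    by (simp add: matrix_vector_mul_assoc positive_definite_matrix_inv_right[OF Q])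
  have state: "(A ** Q + B ** L) *v \<xi> + E *v \<omega> = v'"
    and readout: "(C1 ** Q + D1 ** L) *v \<xi> = (C1 + D1 ** K) *v v"
    unfolding \<xi>_def v'_def K_def
    by (simp_all add: matrix_vector_mult_add_rdistrib matrix_vector_mul_assoc[symmetric] Q_inv)
  have "z \<bullet> (Q *v z) = V v'" and "z \<bullet> v' = - V v'" and "\<xi> \<bullet> (Q *v \<xi>) = V v"
    unfolding z_def \<xi>_def V_def
    by (simp_all add: matrix_vector_mult_minus_right Q_inv inner_commute)
  then have form: "z \<bullet> (Q *v z) + 2 * (z \<bullet> ((A ** Q + B ** L) *v \<xi> + E *v \<omega>)) + \<xi> \<bullet> (Q *v \<xi>)
      + \<gamma>\<^sup>2 * (norm \<omega>)\<^sup>2 - (norm ((C1 ** Q + D1 ** L) *v \<xi> + E1 *v \<omega>))\<^sup>2 = bound - V v'"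
    unfolding state readout bound_def by simp
  note ineq = design_inequality_on_compatible_systems[OF compat psd \<beta>,
      where z = z and \<xi> = \<xi> and \<omega> = \<omega>, unfolded form]
  show "V ((A + B ** K) *v v + E *v \<omega>) \<le> bound"
    using ineq(1) unfolding v'_def by simp
  assume "v \<noteq> 0"
  then show "V ((A + B ** K) *v v + E *v \<omega>) < bound"
    using ineq(2) unfolding v'_def by (simp add: \<xi>_def Q_inv)
qed

lemma positive_definite_matrix_inv_form:
  assumes Q: "positive_definite Q" and "v \<noteq> 0"
  shows "0 < v \<bullet> (matrix_inv Q *v v)"
proof -
  let ?\<xi> = "matrix_inv Q *v v"
  have v: "Q *v ?\<xi> = v" by (simp add: matrix_vector_mul_assoc positive_definite_matrix_inv_right[OF Q])
  then have "?\<xi> \<noteq> 0" using assms(2) by auto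
  then have "0 < ?\<xi> \<bullet> (Q *v ?\<xi>)" using Q by (simp add: positive_definite_def)
  then show ?thesis by (simp add: v inner_commute)
qed

theorem lemma2:
  fixes A\<nu> :: "real^'p^'p" and B\<nu> :: "real^'q^'p" and E\<nu> :: "real^'l^'p"
    and C1 :: "real^'p^'r" and D1 :: "real^'q^'r" and E1 :: "real^'l^'r"
    and x :: "nat \<Rightarrow> real^'p" and u :: "nat \<Rightarrow> real^'q" and w :: "nat \<Rightarrow> real^'l"
    and Xp Xm :: "real^('t::{finite,linorder})^'p"
    and U :: "real^('t::{finite,linorder})^'q" and W :: "real^('t::{finite,linorder})^'l"
    and \<alpha> :: real and \<alpha>t :: "nat \<Rightarrow> real"
    and \<gamma> lam \<beta> :: real
    and Q :: "real^'p^'p" and L K :: "real^'p^'q" and CL :: "real^'p^'r"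
  assumes "stabilizable A\<nu> B\<nu>" and "observable C1 A\<nu>"
    and "\<forall>t<CARD('t). x (Suc t) = A\<nu> *v x t + B\<nu> *v u t + E\<nu> *v w t"
    and "0 \<le> \<alpha>" and "(\<Sum>t<CARD('t). (norm (w t))\<^sup>2) \<le> \<alpha>"
    and "\<forall>t<CARD('t). 0 \<le> \<alpha>t t \<and> (norm (w t))\<^sup>2 \<le> \<alpha>t t"
    and "Xm = data_matrix x" and "Xp = shifted_data_matrix x"
    and "U = data_matrix u" and "W = data_matrix w"
    and "0 < \<gamma>" and "0 \<le> \<beta>"
    and "positive_definite Q"
    and "CL = C1 ** Q + D1 ** L"
    and "positive_semidefinite (design_block Q L CL E1 \<beta> \<gamma>
           + lam *\<^sub>R (data_block Xp Xm U W ** transpose (data_block Xp Xm U W)))"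
    and "positive_definite (performance_block Q CL E1 \<gamma>)"
    and "K = L ** matrix_inv Q"
  shows "\<forall>(A, B, E) \<in> compatible_systems Xp Xm U W.
           asymptotically_stable (A + B ** K) \<and>
           Hinf_performance (A + B ** K) E (C1 + D1 ** K) E1 \<gamma>"
proof (intro ballI, clarify)
  fix A B E
  assume "(A, B, E) \<in> compatible_systems Xp Xm U W"
  note dissip = closed_loop_dissipation[OF this assms(15)[unfolded assms(14)] assms(12,13),
      folded assms(17)]
  define V where "V = (\<lambda>v. v \<bullet> (matrix_inv Q *v v))"
  have pos: "0 < V v" if "v \<noteq> 0" for v
    unfolding V_def using assms(13) that by (rule positive_definite_matrix_inv_form)
  have zero: "V 0 = 0" by (simp add: V_def)
  have "asymptotically_stable (A + B ** K)"
  proof (rule asymptotically_stable_if_strict_Lyapunov[where S = "matrix_inv Q"])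
    fix v :: "real^'p" assume v: "v \<noteq> 0"
    show "0 < v \<bullet> (matrix_inv Q *v v)" using pos[OF v] by (simp add: V_def)
    have "V ((A + B ** K) *v v) < V v - (norm ((C1 + D1 ** K) *v v))\<^sup>2"
      using dissip(2)[OF v, of 0] by (simp add: V_def)
    also have "\<dots> \<le> V v" by simp
    finally show "((A + B ** K) *v v) \<bullet> (matrix_inv Q *v ((A + B ** K) *v v))
        < v \<bullet> (matrix_inv Q *v v)" by (simp add: V_def)
  qed
  moreover have "Hinf_performance (A + B ** K) E (C1 + D1 ** K) E1 \<gamma>"
  proof (rule Hinf_performance_if_dissipative[where V = V])
    show "0 \<le> V v" for v using pos[of v] zero by (cases "v = 0") auto
    show "V ((A + B ** K) *v v + E *v \<omega>)
        \<le> V v + \<gamma>\<^sup>2 * (norm \<omega>)\<^sup>2 - (norm ((C1 + D1 ** K) *v v + E1 *v \<omega>))\<^sup>2" for v \<omega>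
      unfolding V_def by (rule dissip(1))
  qed (rule zero)
  ultimately show "asymptotically_stable (A + B ** K) \<and>
      Hinf_performance (A + B ** K) E (C1 + D1 ** K) E1 \<gamma>" ..
qed

end
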